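(* Consider the system $x(t+1)=A_{\mathrm o}x(t)+B_{\mathrm o}u(t)+w(t)$, $y_1(t)=C_1x(t)+D_1u(t)$, $y_2(t)=C_2x(t)+D_2u(t)$ controlled by the moving-horizon scheme described in the context, with online optimization problem $\mathcal{P}_t$ at time $t$, and let the offline data satisfy Assumption 1 (in the context). Suppose $\mathcal{P}_t$ is feasible at time $t\in\mathbb{N}$ and let $(\eta_t,Q_t,Y_t,\alpha_t,\beta_t)$ denote a solution (the one used for the control $u(t)=Y_tQ_t^{-1}x(t)$ at time $t$). If at time $t+1$ the forecasted disturbance energy bound $\sigma_{t+1}$ satisfies $\sigma_{t+1}\le\sigma_t-\|w(t)\|^2$ and the parameter $r_{t+1}$ is chosen as $r_{t+1}=r_t$, then $\mathcal{P}_{t+1}$ is feasible. In particular, in this case, $(\eta_t,Q_t,Y_t,\alpha_t,\beta_t)$ is also a (feasible) solution of $\mathcal{P}_{t+1}$.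
   Context: Setting: $x(t)\in\mathbb{R}^n$ is the state, $u(t)\in\mathbb{R}^m$ the control, $w(t)\in\mathbb{R}^n$ an unmeasured disturbance, $y_1(t)\in\mathbb{R}^{p_1}$, $y_2(t)\in\mathbb{R}^{p_2}$ outputs; all matrices are real, of compatible dimensions. Standing assumptions: $(A_{\mathrm o},B_{\mathrm o})$ is stabilizable and $(C_1,A_{\mathrm o})$ is detectable. $y_{2v,\max}\ge0$ ($v=1,\dots,p_2$) are given bounds, $e_v$ is the $v$th standard basis vector of $\mathbb{R}^{p_2}$, and $\|\cdot\|$ is the Euclidean norm. $\succ,\succeq,\prec$ denote the usual (semi)definite orders on symmetric matrices. Offline data: $\{(x_j^+,x_j,u_j)\}_{j=1}^J$ with $x_j^+=A_{\mathrm o}x_j+B_{\mathrm o}u_j+w_j$, where $w_j\in\mathbb{R}^n$ are unknown disturbance values. Set $X^+=[x_1^+,\dots,x_J^+]$, $X=[x_1,\dots,x_J]$, $U=[u_1,\dots,u_J]$, $W=[w_1,\dots,w_J]$, so $W=X^+-A_{\mathrm o}X-B_{\mathrm o}U$. Assumption 1: $$\begin{bmatrix}I\\ W^{\top}\end{bmatrix}^{\top}\begin{bmatrix}\Phi_{11}&\Phi_{12}\\ \Phi_{12}^{\top}&\Phi_{22}\end{bmatrix}\begin{bmatrix}I\\ W^{\top}\end{bmatrix}\succeq0,$$ where $\Phi_{11}=\Phi_{11}^{\top}\in\mathbb{R}^{n\times n}$, $\Phi_{12}\in\mathbb{R}^{n\times J}$, $\Phi_{22}=\Phi_{22}^{\top}\in\mathbb{R}^{J\times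 J}$ with $\Phi_{22}\prec0$ are known matrices. Data matrix $N\in\mathbb{R}^{(2n+m)\times(2n+m)}$: the symmetric matrix $$N=\begin{bmatrix}\Theta&\star&\star\\-X\Phi_{12}^{\top}-X\Phi_{22}(X^+)^{\top}&X\Phi_{22}X^{\top}&\star\\-U\Phi_{12}^{\top}-U\Phi_{22}(X^+)^{\top}&U\Phi_{22}X^{\top}&U\Phi_{22}U^{\top}\end{bmatrix},$$ with $\Theta=\Phi_{11}+X^+\Phi_{12}^{\top}+\Phi_{12}(X^+)^{\top}+X^+\Phi_{22}(X^+)^{\top}$, where $\star$ denotes the transpose of the corresponding block below the diagonal. Online problem $\mathcal{P}_t$ at time $t\in\mathbb{N}$: maximize $\eta$ over $\eta>0$, $Q=Q^{\top}\in\mathbb{R}^{n\times n}$, $Y\in\mathbb{R}^{m\times n}$, $\alpha\ge0$, $\beta>0$ subject to $$\begin{bmatrix} Q-(\eta+\beta)I & 0&0&0&0\\ 0&0&0&Q&0\\ 0&0&0&Y&0\\ 0&Q&Y^{\top}&Q&(C_1Q+D_1Y)^{\top}\\ 0&0&0&C_1Q+D_1Y&I\end{bmatrix}\succeq\alpha\begin{bmatrix}N&0\\0&0\end{bmatrix}$$ (block sizes $n,n,m,n,p_1$; $N$ is padded by zero blocks), $$\begin{bmatrix}Q&(C_1Q+D_1Y)^{\top}\\ C_1Q+D_1Y&I\end{bmatrix}\succ0,\qquad \begin{bmatrix}r_t&x(t)^{\top}&1\\ x(t)&Q&0\\1&0&\sigma_t^{-1}\eta\end{bmatrix}\succeq0,$$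 $$\begin{bmatrix}y_{2v,\max}^2\,r_t^{-1}&e_v^{\top}(C_2Q+D_2Y)\\(C_2Q+D_2Y)^{\top}e_v&Q\end{bmatrix}\succeq0,\quad v=1,\dots,p_2,$$ and, for $t\ge1$ only (this constraint is excluded at $t=0$), $$\begin{bmatrix}x(t)^{\top}P_{t-1}x(t)+\Delta_t&x(t)^{\top}\\ x(t)&Q\end{bmatrix}\succeq0 .$$ Here $x(t)$ is the current state, $\sigma_t>0$ is a forecasted bound on the total energy of present and future disturbances ($\sum_{i=t}^\infty\|w(i)\|^2\le\sigma_t$), and $r_t>0$ is a design parameter. Moving-horizon scheme: at each time $s$ a solution $(\eta_s,Q_s,Y_s,\alpha_s,\beta_s)$ of $\mathcal{P}_s$ is computed, one sets $P_s=Q_s^{-1}$, $K_s=Y_sQ_s^{-1}$, and applies $u(s)=K_sx(s)$; $\Delta_t$ is defined by $\Delta_1=0$ and, for $t\ge2$, $$\Delta_t=\Delta_{t-1}-\big(x(t-1)^{\top}P_{t-1}x(t-1)-x(t-1)^{\top}P_{t-2}x(t-1)\big).$$ "Solution" means a feasible point (values of the decision variables satisfying all constraints), not necessarily optimal. *)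

theory Defs
  imports "HOL-Analysis.Analysis"
begin

text \<open>Block matrices are indexed by sum types. Both operators associate to the left, so that
  the index type of the leading three blocks of a five-block matrix is a component of the index
  type of the whole matrix.\<close>

definition hcat :: "'a ^ 'c ^ 'r \<Rightarrow> 'a ^ 'd ^ 'r \<Rightarrow> 'a ^ ('c + 'd) ^ 'r"  (infixl "|||" 60)
  where "A ||| B = (\<chi> i j. case j of Inl k \<Rightarrow> A $ i $ k | Inr k \<Rightarrow> B $ i $ k)"

definition vcat :: "'a ^ 'c ^ 'r \<Rightarrow> 'a ^ 'c ^ 's \<Rightarrow> 'a ^ 'c ^ ('r + 's)"  (infixl "'/'/'/" 55)
  where "A /// B = (\<chi> i. case i of Inl k \<Rightarrow> A $ k | Inr k \<Rightarrow> B $ k)"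

definition of_cols :: "('j \<Rightarrow> 'a ^ 'n) \<Rightarrow> 'a ^ 'j ^ 'n"
  where "of_cols c = (\<chi> i j. c j $ i)"

definition pos_semidef :: "real ^ 'n ^ 'n \<Rightarrow> bool"
  where "pos_semidef M \<longleftrightarrow> transpose M = M \<and> (\<forall>v. 0 \<le> v \<bullet> (M *v v))"

definition pos_def :: "real ^ 'n ^ 'n \<Rightarrow> bool"
  where "pos_def M \<longleftrightarrow> transpose M = M \<and> (\<forall>v. v \<noteq> 0 \<longrightarrow> 0 < v \<bullet> (M *v v))"

text \<open>Discrete-time stability: all complex eigenvalues lie in the open unit disc.\<close>

definition schur_stable :: "real ^ 'n ^ 'n \<Rightarrow> bool"
  where "schur_stable A \<longleftrightarrow>
    (\<forall>(z::complex) v. v \<noteq> 0 \<and> map_matrix complex_of_real A *v v = z *s v \<longrightarrow> norm z < 1)"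

definition stabilizable :: "real ^ 'n ^ 'n \<Rightarrow> real ^ 'm ^ 'n \<Rightarrow> bool"
  where "stabilizable A B \<longleftrightarrow> (\<exists>K. schur_stable (A + B ** K))"

definition detectable :: "real ^ 'n ^ 'p \<Rightarrow> real ^ 'n ^ 'n \<Rightarrow> bool"
  where "detectable C A \<longleftrightarrow> (\<exists>L. schur_stable (A + L ** C))"

definition noise_bound ::
  "real ^ 'n ^ 'n \<Rightarrow> real ^ 'j ^ 'n \<Rightarrow> real ^ 'j ^ 'j \<Rightarrow> real ^ 'j ^ 'n \<Rightarrow> bool"
  where "noise_bound \<Phi>11 \<Phi>12 \<Phi>22 W \<longleftrightarrow>
    pos_semidef (transpose (mat 1 /// transpose W) **
      ((\<Phi>11 ||| \<Phi>12) ///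
       (transpose \<Phi>12 ||| \<Phi>22)) **
      (mat 1 /// transpose W))"

definition data_matrix ::
  "real ^ 'n ^ 'n \<Rightarrow> real ^ 'j ^ 'n \<Rightarrow> real ^ 'j ^ 'j \<Rightarrow>
   real ^ 'j ^ 'n \<Rightarrow> real ^ 'j ^ 'n \<Rightarrow> real ^ 'j ^ 'm \<Rightarrow> real ^ (('n + 'n) + 'm) ^ (('n + 'n) + 'm)"
  where "data_matrix \<Phi>11 \<Phi>12 \<Phi>22 Xp X U =
    (let \<Theta> = \<Phi>11 + Xp ** transpose \<Phi>12 + \<Phi>12 ** transpose Xp + Xp ** \<Phi>22 ** transpose Xp;
         N21 = - (X ** transpose \<Phi>12) - X ** \<Phi>22 ** transpose Xp;
         N31 = - (U ** transpose \<Phi>12) - U ** \<Phi>22 ** transpose Xp;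
         N32 = U ** \<Phi>22 ** transpose X
     in (\<Theta> ||| transpose N21 ||| transpose N31) ///
        (N21 ||| X ** \<Phi>22 ** transpose X ||| transpose N32) ///
        (N31 ||| N32 ||| U ** \<Phi>22 ** transpose U))"

text \<open>The scalars \<open>\<Delta>\<^sub>t\<close>, which are defined for \<open>t \<ge> 1\<close> only; the value at 0 is never used.\<close>

fun slack :: "(nat \<Rightarrow> real ^ 'n ^ 'n) \<Rightarrow> (nat \<Rightarrow> real ^ 'n) \<Rightarrow> nat \<Rightarrow> real"
  where
    "slack P x 0 = 0"
  | "slack P x (Suc 0) = 0"
  | "slack P x (Suc (Suc s)) = slack P x (Suc s) -
       (x (Suc s) \<bullet> (P (Suc s) *v x (Suc s)) - x (Suc s) \<bullet> (P s *v x (Suc s)))"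

text \<open>\<open>mpc_solution \<dots> P x t \<eta> Q Y \<alpha> \<beta>\<close> says that \<open>(\<eta>, Q, Y, \<alpha>, \<beta>)\<close> satisfies all constraints of
  the online problem at time \<open>t\<close>. Solutions need not be optimal, so the objective
  (maximize \<open>\<eta>\<close>) plays no role. Of the sequence \<open>P\<close> only the entries before time \<open>t\<close> matter.\<close>

definition mpc_solution ::
  "real ^ (('n + 'n) + 'm) ^ (('n + 'n) + 'm) \<Rightarrow>
   real ^ 'n ^ 'p1 \<Rightarrow> real ^ 'm ^ 'p1 \<Rightarrow> real ^ 'n ^ 'p2 \<Rightarrow> real ^ 'm ^ 'p2 \<Rightarrow> ('p2 \<Rightarrow> real) \<Rightarrow>
   (nat \<Rightarrow> real) \<Rightarrow> (nat \<Rightarrow> real) \<Rightarrow> (nat \<Rightarrow> real ^ 'n ^ 'n) \<Rightarrow> (nat \<Rightarrow> real ^ 'n) \<Rightarrow> nat \<Rightarrow>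
   real \<Rightarrow> real ^ 'n ^ 'n \<Rightarrow> real ^ 'n ^ 'm \<Rightarrow> real \<Rightarrow> real \<Rightarrow> bool"
  where "mpc_solution N C1 D1 C2 D2 y2max \<sigma> r P x t \<eta> Q Y \<alpha> \<beta> \<longleftrightarrow>
    \<eta> > 0 \<and> transpose Q = Q \<and> \<alpha> \<ge> 0 \<and> \<beta> > 0 \<and>
    pos_semidef
      (((Q - mat (\<eta> + \<beta>) ||| 0 ||| 0 ||| 0 ||| 0) ///
        (0 ||| 0 ||| 0 ||| Q ||| 0) ///
        (0 ||| 0 ||| 0 ||| Y ||| 0) ///
        (0 ||| Q ||| transpose Y ||| Q ||| transpose (C1 ** Q + D1 ** Y)) ///
        (0 ||| 0 ||| 0 ||| C1 ** Q + D1 ** Y ||| mat 1))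
       - \<alpha> *\<^sub>R ((N ||| 0 ||| 0) /// 0 /// 0)) \<and>
    pos_def
      ((Q ||| transpose (C1 ** Q + D1 ** Y)) ///
       (C1 ** Q + D1 ** Y ||| mat 1)) \<and>
    pos_semidef
      (((mat (r t) :: real ^ 1 ^ 1) ||| rowvector (x t) ||| (mat 1 :: real ^ 1 ^ 1)) ///
       (columnvector (x t) ||| Q ||| 0) ///
       (mat 1 ||| 0 ||| mat (inverse (\<sigma> t) * \<eta>))) \<and>
    (\<forall>v. pos_semidef
      (((mat ((y2max v)\<^sup>2 * inverse (r t)) :: real ^ 1 ^ 1)
          ||| rowvector (axis v 1) ** (C2 ** Q + D2 ** Y)) ///
       (transpose (C2 ** Q + D2 ** Y) ** columnvector (axis v 1) ||| Q))) \<and>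
    (t \<ge> 1 \<longrightarrow> pos_semidef
      (((mat (x t \<bullet> (P (t - 1) *v x t) + slack P x t) :: real ^ 1 ^ 1) ||| rowvector (x t)) ///
       (columnvector (x t) ||| Q)))"

definition mpc_feasible ::
  "real ^ (('n + 'n) + 'm) ^ (('n + 'n) + 'm) \<Rightarrow>
   real ^ 'n ^ 'p1 \<Rightarrow> real ^ 'm ^ 'p1 \<Rightarrow> real ^ 'n ^ 'p2 \<Rightarrow> real ^ 'm ^ 'p2 \<Rightarrow> ('p2 \<Rightarrow> real) \<Rightarrow>
   (nat \<Rightarrow> real) \<Rightarrow> (nat \<Rightarrow> real) \<Rightarrow> (nat \<Rightarrow> real ^ 'n ^ 'n) \<Rightarrow> (nat \<Rightarrow> real ^ 'n) \<Rightarrow> nat \<Rightarrow> bool"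
  where "mpc_feasible N C1 D1 C2 D2 y2max \<sigma> r P x t \<longleftrightarrow>
    (\<exists>\<eta> Q Y \<alpha> \<beta>. mpc_solution N C1 D1 C2 D2 y2max \<sigma> r P x t \<eta> Q Y \<alpha> \<beta>)"

end

theory Submission
  imports Defs
begin

text \<open>
  Only two constraints of the online problem involve data that differ between times \<open>t\<close> and
  \<open>t + 1\<close>: the one bounding the initial energy and, from time 1 on, the one comparing the new
  Lyapunov matrix with the previous one. The LMI that encodes dissipation for all data-consistent
  systems does not mention time, and the output constraint depends on it only through
  \<open>r\<close>, which is kept. So it suffices to re-establish the two for the old solution, where
  \<open>P = Q\<inverse>\<close>.

  By Schur complements the energy constraint reads \<open>x \<bullet> P x + \<sigma> / \<eta> \<le> r\<close> and the comparison
  constraint reads \<open>x \<bullet> P x \<le> c\<close> with \<open>c\<close> its top left entry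
  (\<open>pos_semidef_doubly_bordered_iff\<close>, \<open>pos_semidef_bordered_iff\<close>).

  For the energy constraint, the heart is the dissipation inequality
  \<open>x' \<bullet> P x' \<le> x \<bullet> P x + \<parallel>w\<parallel>\<^sup>2 / \<eta>\<close> for one closed-loop step
  (\<open>closed_loop_dissipation\<close>): the energy of the state grows by at most what the forecast
  \<open>\<sigma>\<close> gives up, as \<open>\<sigma>\<^sub>t\<^sub>+\<^sub>1 \<le> \<sigma>\<^sub>t - \<parallel>w\<^sub>t\<parallel>\<^sup>2\<close>. It follows from the LMI because the true
  system is consistent with the data: along the vectors \<open>(v, A\<^sup>T v, B\<^sup>T v)\<close> the quadratic form of
  the data matrix \<open>N\<close> is that of the noise bound, hence nonnegative
  (\<open>data_matrix_consistent_nonneg\<close>).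

  For the comparison constraint at time \<open>t + 1\<close>, the reference matrix is the old \<open>P\<close> itself, so
  it only says that the slack \<open>\<Delta>\<^sub>t\<^sub>+\<^sub>1\<close> is nonnegative. The recursion for \<open>\<Delta>\<close> is
  made such that this is the comparison constraint at time \<open>t\<close> (\<open>slack_Suc_nonneg\<close>).
\<close>

section \<open>Block vectors and block matrices\<close>

text \<open>Every vector over a sum index type is such a concatenation, so the quadratic form of a block
  matrix can be computed blockwise.\<close>

definition vjoin :: "real ^ 'a \<Rightarrow> real ^ 'b \<Rightarrow> real ^ ('a + 'b)"
  where "vjoin a b = (\<chi> i. case i of Inl k \<Rightarrow> a $ k | Inr k \<Rightarrow> b $ k)"

lemma vjoin_exhaust:
  obtains a b where "v = vjoin a b"
proof
  show "v = vjoin (\<chi> i. v $ Inl i) (\<chi> i. v $ Inr i)"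
    by (auto simp: vjoin_def vec_eq_iff split: sum.split)
qed

lemma sum_UNIV_Plus:
  fixes f :: "'a::finite + 'b::finite \<Rightarrow> 'c::comm_monoid_add"
  shows "(\<Sum>i\<in>UNIV. f i) = (\<Sum>i\<in>UNIV. f (Inl i)) + (\<Sum>i\<in>UNIV. f (Inr i))"
  by (simp add: sum.Plus flip: UNIV_Plus_UNIV)

lemma inner_vjoin [simp]: "vjoin a b \<bullet> vjoin c d = a \<bullet> c + b \<bullet> d"
  by (simp add: inner_vec_def vjoin_def sum_UNIV_Plus)

lemma vjoin_linear [simp]:
  "vjoin a b - vjoin c d = vjoin (a - c) (b - d)"
  "k *\<^sub>R vjoin a b = vjoin (k *\<^sub>R a) (k *\<^sub>R b)"
  by (auto simp: vjoin_def vec_eq_iff split: sum.split)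

lemma vjoin_eq_0_iff [simp]: "vjoin a b = 0 \<longleftrightarrow> a = 0 \<and> b = 0"
  by (auto simp: vjoin_def vec_eq_iff split: sum.splits)

lemma hcat_mult_vjoin [simp]: "(A ||| B) *v vjoin a b = A *v a + B *v b"
  by (simp add: hcat_def vjoin_def matrix_vector_mult_def sum_UNIV_Plus vec_eq_iff)

lemma vcat_mult [simp]:
  fixes A :: "real ^ 'c ^ 'r"
  shows "(A /// B) *v v = vjoin (A *v v) (B *v v)"
  by (auto simp: vcat_def vjoin_def matrix_vector_mult_def vec_eq_iff split: sum.split)

lemma transpose_hcat: "transpose (A ||| B) = (transpose A /// transpose B)"
  by (auto simp: transpose_def hcat_def vcat_def vec_eq_iff split: sum.split)

lemma transpose_vcat: "transpose (A /// B) = (transpose A ||| transpose B)"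
  by (auto simp: transpose_def hcat_def vcat_def vec_eq_iff split: sum.split)

text \<open>The interchange law puts a transposed block matrix, which comes out as columns of blocks, back
  into the form of rows of blocks. Symmetry of a block matrix can then be read off its blocks.\<close>

lemma hcat_of_vcat: "(A /// B) ||| (C /// D) = ((A ||| C) /// (B ||| D))"
  by (auto simp: hcat_def vcat_def vec_eq_iff split: sum.split)

lemma transpose_special [simp]:
  "transpose (rowvector x) = columnvector x"
  "transpose (columnvector x) = rowvector x"
  "transpose (0 :: real ^ 'a ^ 'b) = 0"
  by (simp_all add: transpose_def rowvector_def columnvector_def vec_eq_iff)

lemma mat_mult_vector [simp]: "mat c *v v = c *\<^sub>R (v :: real ^ 'n)"
  by (simp add: mat_def matrix_vector_mult_def vec_eq_iff if_distrib if_distribR cong: if_cong)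

lemma rowvector_mult [simp]: "a \<bullet> (rowvector x *v v) = (a :: real ^ 1) $ 1 * (x \<bullet> v)"
  by (simp add: rowvector_def matrix_vector_mult_def inner_vec_def)

lemma columnvector_mult [simp]: "columnvector x *v a = (a :: real ^ 1) $ 1 *\<^sub>R x"
  by (simp add: columnvector_def matrix_vector_mult_def vec_eq_iff)

lemma inner_real_1: "a \<bullet> b = (a :: real ^ 1) $ 1 * b $ 1"
  by (simp add: inner_vec_def)

text \<open>The adjoint law, oriented so that rewriting removes transposes inside quadratic forms.\<close>

lemma inner_transpose_mult:
  fixes A :: "real ^ 'n ^ 'm"
  shows "y \<bullet> (transpose A *v x) = x \<bullet> (A *v y)"
  by (simp add: dot_lmul_matrix inner_commute[of y])

lemma matrix_vector_mult_minus: "A *v (- v) = - (A *v v)" for A :: "real ^ 'n ^ 'm"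
  using matrix_vector_mult_diff_distrib[of A 0 v] by simp

lemma matrix_vector_minus_mult: "(- A) *v v = - (A *v v)" for A :: "real ^ 'n ^ 'm"
  using matrix_vector_mult_diff_rdistrib[of 0 A v] by simp

section \<open>Schur complements of bordered matrices\<close>

lemma pos_def_matrix_inv:
  fixes Q :: "real ^ 'n ^ 'n"
  assumes "pos_def Q"
  shows "Q ** matrix_inv Q = mat 1" "matrix_inv Q ** Q = mat 1"
proof -
  have "v = 0" if "Q *v v = 0" for v
    using assms that by (auto simp: pos_def_def dest!: spec[of _ v])
  then have "invertible Q"
    by (simp add: invertible_left_inverse matrix_left_invertible_ker)
  then have "\<exists>Q'. Q ** Q' = mat 1 \<and> Q' ** Q = mat 1"
    by (simp add: invertible_def)
  then have "Q ** matrix_inv Q = mat 1 \<and> matrix_inv Q ** Q = mat 1"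
    unfolding matrix_inv_def by (rule someI_ex)
  then show "Q ** matrix_inv Q = mat 1" "matrix_inv Q ** Q = mat 1"
    by simp_all
qed

text \<open>The Schur complement, on the level of quadratic forms: completing the square in \<open>v\<close> leaves
  \<open>(c - x \<bullet> Q\<inverse> x) a\<^sup>2\<close>, and the square vanishes at \<open>v = - a Q\<inverse> x\<close>.\<close>

lemma form_lower_bound_iff:
  fixes Q :: "real ^ 'n ^ 'n"
  assumes "pos_def Q"
  shows "(\<forall>a v. 0 \<le> c * a\<^sup>2 + 2 * a * (x \<bullet> v) + v \<bullet> (Q *v v)) \<longleftrightarrow> x \<bullet> (matrix_inv Q *v x) \<le> c"
proof -
  define p where "p = matrix_inv Q *v x"
  have Qp: "Q *v p = x"
    using pos_def_matrix_inv[OF assms] by (simp add: p_def matrix_vector_mul_assoc)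
  have sym: "transpose Q = Q"
    using assms by (simp add: pos_def_def)
  have psd: "0 \<le> v \<bullet> (Q *v v)" for v
    using assms by (cases "v = 0") (auto simp: pos_def_def intro: less_imp_le)
  have square: "c * a\<^sup>2 + 2 * a * (x \<bullet> v) + v \<bullet> (Q *v v)
      = (c - x \<bullet> p) * a\<^sup>2 + (v + a *\<^sub>R p) \<bullet> (Q *v (v + a *\<^sub>R p))" for a v
  proof -
    have "p \<bullet> (Q *v v) = x \<bullet> v"
      using inner_transpose_mult[of p Q v] by (simp only: sym Qp inner_commute)
    then show ?thesis
      by (simp add: algebra_simps inner_simps matrix_vector_mult_scaleR Qp power2_eq_square
            inner_commute[of p x] inner_commute[of v x])
  qed
  show ?thesis
    unfolding square p_def[symmetric]
  proof
    assume *: "\<forall>a v. 0 \<le> (c - x \<bullet> p) * a\<^sup>2 + (v + a *\<^sub>R p) \<bullet> (Q *v (v + a *\<^sub>R p))"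
    show "x \<bullet> p \<le> c"
      using *[rule_format, of 1 "- p"] by simp
  next
    assume "x \<bullet> p \<le> c"
    then show "\<forall>a v. 0 \<le> (c - x \<bullet> p) * a\<^sup>2 + (v + a *\<^sub>R p) \<bullet> (Q *v (v + a *\<^sub>R p))"
      by (simp add: psd)
  qed
qed

lemma pos_semidef_bordered_iff:
  fixes Q :: "real ^ 'n ^ 'n"
  assumes Q: "pos_def Q"
  shows "pos_semidef (((mat c :: real ^ 1 ^ 1) ||| rowvector x) /// (columnvector x ||| Q))
    \<longleftrightarrow> x \<bullet> (matrix_inv Q *v x) \<le> c" (is "pos_semidef ?M \<longleftrightarrow> _")
proof -
  have sym: "transpose ?M = ?M"
    using Q by (simp add: transpose_vcat transpose_hcat hcat_of_vcat pos_def_def)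
  have form: "vjoin a v \<bullet> (?M *v vjoin a v) = c * (a $ 1)\<^sup>2 + 2 * (a $ 1) * (x \<bullet> v) + v \<bullet> (Q *v v)"
    for a v
    by (simp add: inner_simps inner_real_1[of a a] inner_commute[of v x] power2_eq_square)
  have "pos_semidef ?M \<longleftrightarrow> (\<forall>a v. 0 \<le> vjoin a v \<bullet> (?M *v vjoin a v))"
    unfolding pos_semidef_def using sym by (metis vjoin_exhaust)
  also have "\<dots> \<longleftrightarrow> (\<forall>a v. 0 \<le> c * a\<^sup>2 + 2 * a * (x \<bullet> v) + v \<bullet> (Q *v v))"
    unfolding form by (metis vec_component)
  finally show ?thesis
    using form_lower_bound_iff[OF Q] by simp
qed

text \<open>The last variable is eliminated by its own completed square \<open>s (b + a / s)\<^sup>2\<close>, which lowers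
  the coefficient of \<open>a\<^sup>2\<close> from \<open>r\<close> to \<open>r - 1 / s\<close> and leaves a singly bordered form.\<close>

lemma pos_semidef_doubly_bordered_iff:
  fixes Q :: "real ^ 'n ^ 'n"
  assumes Q: "pos_def Q" and s: "s > 0"
  shows "pos_semidef
      (((mat r :: real ^ 1 ^ 1) ||| rowvector x ||| (mat 1 :: real ^ 1 ^ 1)) ///
       (columnvector x ||| Q ||| 0) ///
       (mat 1 ||| 0 ||| mat s))
    \<longleftrightarrow> x \<bullet> (matrix_inv Q *v x) + 1 / s \<le> r" (is "pos_semidef ?M \<longleftrightarrow> _")
proof -
  have sym: "transpose ?M = ?M"
    using Q by (simp add: transpose_vcat transpose_hcat hcat_of_vcat pos_def_def)
  have form: "vjoin (vjoin a v) b \<bullet> (?M *v vjoin (vjoin a v) b)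
      = ((r - 1 / s) * (a $ 1)\<^sup>2 + 2 * (a $ 1) * (x \<bullet> v) + v \<bullet> (Q *v v))
        + s * (b $ 1 + a $ 1 / s)\<^sup>2" for a v b
    using s by (simp add: inner_simps inner_real_1[of a] inner_real_1[of b] inner_commute[of v x]
                  power2_eq_square field_simps)
  have "pos_semidef ?M \<longleftrightarrow> (\<forall>a v b. 0 \<le> vjoin (vjoin a v) b \<bullet> (?M *v vjoin (vjoin a v) b))"
    unfolding pos_semidef_def using sym by (metis vjoin_exhaust)
  also have "\<dots> \<longleftrightarrow> (\<forall>a v. 0 \<le> (r - 1 / s) * a\<^sup>2 + 2 * a * (x \<bullet> v) + v \<bullet> (Q *v v))"
  proof
    assume *: "\<forall>a v b. 0 \<le> vjoin (vjoin a v) b \<bullet> (?M *v vjoin (vjoin a v) b)"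
    show "\<forall>a v. 0 \<le> (r - 1 / s) * a\<^sup>2 + 2 * a * (x \<bullet> v) + v \<bullet> (Q *v v)"
    proof (intro allI)
      fix a v
      show "0 \<le> (r - 1 / s) * a\<^sup>2 + 2 * a * (x \<bullet> v) + v \<bullet> (Q *v v)"
        using *[unfolded form, rule_format, of "vec a" v "vec (- a / s)"] by simp
    qed
  next
    assume "\<forall>a v. 0 \<le> (r - 1 / s) * a\<^sup>2 + 2 * a * (x \<bullet> v) + v \<bullet> (Q *v v)"
    then show "\<forall>a v b. 0 \<le> vjoin (vjoin a v) b \<bullet> (?M *v vjoin (vjoin a v) b)"
      unfolding form using s by simp
  qed
  also have "\<dots> \<longleftrightarrow> x \<bullet> (matrix_inv Q *v x) + 1 / s \<le> r"
    by (simp add: form_lower_bound_iff[OF Q] le_diff_eq)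
  finally show ?thesis .
qed

lemma pos_def_upper_left:
  assumes "pos_def ((A ||| B) /// (C ||| D))" "transpose A = A"
  shows "pos_def A"
  unfolding pos_def_def
proof (intro conjI allI impI)
  fix v :: "real ^ 'a" assume "v \<noteq> 0"
  then have "0 < vjoin v 0 \<bullet> (((A ||| B) /// (C ||| D)) *v vjoin v 0)"
    using assms(1) unfolding pos_def_def by (metis vjoin_eq_0_iff)
  then show "0 < v \<bullet> (A *v v)"
    by simp
qed (fact assms(2))

section \<open>Dissipation along data-consistent systems\<close>

lemma symmetric_blocks_form:
  fixes T :: "real ^ 'a ^ 'a" and R :: "real ^ 'b ^ 'b" and S :: "real ^ 'c ^ 'c"
  shows "vjoin (vjoin a b) c \<bullet>
      (((T ||| transpose L ||| transpose M) ///
        (L ||| R ||| transpose G) ///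
        (M ||| G ||| S)) *v vjoin (vjoin a b) c)
    = a \<bullet> (T *v a) + b \<bullet> (R *v b) + c \<bullet> (S *v c)
      + 2 * (b \<bullet> (L *v a) + c \<bullet> (M *v a) + c \<bullet> (G *v b))"
  by (simp add: inner_add_right inner_transpose_mult del: transpose_matrix_vector)

text \<open>The data matrix is the noise multiplier conjugated by the block matrix with rows
  \<open>(I, X\<^sup>+)\<close>, \<open>(0, -X)\<close> and \<open>(0, -U)\<close>. The transpose of that block matrix sends
  \<open>(v, A\<^sup>T v, B\<^sup>T v)\<close> to \<open>(v, (X\<^sup>+ - A X - B U)\<^sup>T v) = (v, W\<^sup>T v)\<close>, on which the
  multiplier is nonnegative by the noise bound.\<close>

lemma data_matrix_consistent_nonneg:
  fixes A :: "real ^ 'n ^ 'n" and B :: "real ^ 'm ^ 'n"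
    and \<Phi>12 :: "real ^ 'j ^ 'n"
  assumes data: "\<And>j. xdp j = A *v xd j + B *v ud j + wd j"
    and \<Phi>22: "transpose \<Phi>22 = \<Phi>22"
    and noise: "noise_bound \<Phi>11 \<Phi>12 \<Phi>22 (of_cols wd)"
  defines "z \<equiv> \<lambda>v. vjoin (vjoin v (transpose A *v v)) (transpose B *v v)"
  shows "0 \<le> z v \<bullet> (data_matrix \<Phi>11 \<Phi>12 \<Phi>22 (of_cols xdp) (of_cols xd) (of_cols ud) *v z v)"
proof -
  define p q s where "p = transpose (of_cols xdp) *v v"
    and "q = transpose (of_cols xd) *v (transpose A *v v)"
    and "s = transpose (of_cols ud) *v (transpose B *v v)"
  have cols: "(transpose (of_cols c) *v y) $ j = c j \<bullet> y" for c :: "'j \<Rightarrow> real ^ 'k" and y j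
    by (simp add: of_cols_def transpose_def matrix_vector_mult_def inner_vec_def)
  have residual: "transpose (of_cols wd) *v v = p - q - s"
    by (simp add: vec_eq_iff cols p_def q_def s_def data inner_simps inner_transpose_mult
          inner_commute[of v] del: transpose_matrix_vector)
  have \<Phi>22_swap: "a \<bullet> (\<Phi>22 *v b) = b \<bullet> (\<Phi>22 *v a)" for a b
    using inner_transpose_mult[of a \<Phi>22 b] by (simp only: \<Phi>22)
  have A_form: "v \<bullet> (of_cols xdp *v y) = p \<bullet> y"
      "(transpose A *v v) \<bullet> (of_cols xd *v y) = q \<bullet> y"
      "(transpose B *v v) \<bullet> (of_cols ud *v y) = s \<bullet> y"
      "v \<bullet> (\<Phi>12 *v y) = y \<bullet> (transpose \<Phi>12 *v v)" for y
    unfolding p_def q_def s_def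
    by (metis inner_commute inner_transpose_mult)+
  \<comment> \<open>Both forms are quadratic in \<open>v\<close>, \<open>p\<close>, \<open>q\<close>, \<open>s\<close>; moving all data matrices to the other side
    of the inner product reduces their equality to bilinearity.\<close>
  note push = matrix_vector_mult_add_rdistrib matrix_vector_mult_diff_rdistrib
    matrix_vector_minus_mult inner_add_right inner_diff_right inner_minus_right
    matrix_vector_mul_assoc[symmetric]
  have "z v \<bullet> (data_matrix \<Phi>11 \<Phi>12 \<Phi>22 (of_cols xdp) (of_cols xd) (of_cols ud) *v z v)
    = v \<bullet> (\<Phi>11 *v v) + 2 * ((p - q - s) \<bullet> (transpose \<Phi>12 *v v))
      + (p - q - s) \<bullet> (\<Phi>22 *v (p - q - s))"
    unfolding data_matrix_def Let_def z_def symmetric_blocks_form push A_form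
      p_def[symmetric] q_def[symmetric] s_def[symmetric]
    by (simp add: inner_simps matrix_vector_mult_diff_distrib \<Phi>22_swap[of p q] \<Phi>22_swap[of p s] \<Phi>22_swap[of s q])
  also have "\<dots> = vjoin v (p - q - s)
      \<bullet> (((\<Phi>11 ||| \<Phi>12) /// (transpose \<Phi>12 ||| \<Phi>22)) *v vjoin v (p - q - s))"
    using inner_transpose_mult[of "p - q - s" \<Phi>12 v] by (simp add: inner_simps)
  also have "\<dots> = v \<bullet> ((transpose (mat 1 /// transpose (of_cols wd)) **
      ((\<Phi>11 ||| \<Phi>12) /// (transpose \<Phi>12 ||| \<Phi>22)) **
      (mat 1 /// transpose (of_cols wd))) *v v)"
    unfolding matrix_vector_mul_assoc[symmetric] inner_transpose_mult
    by (simp add: residual inner_commute del: transpose_matrix_vector)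
  also have "0 \<le> \<dots>"
    using noise unfolding noise_bound_def pos_semidef_def by blast
  finally show ?thesis .
qed

text \<open>On vectors \<open>(v, A\<^sup>T v, B\<^sup>T v, g, 0)\<close> the LMI, with its data matrix contributing a term of
  favourable sign, makes a form in \<open>v\<close> and \<open>g\<close> nonnegative whose cross term is \<open>v \<bullet> (A Q + B Y) g\<close>. Taking \<open>g = Q\<inverse> x\<close> turns \<open>(A Q + B Y) g\<close> into the
  undisturbed successor \<open>x' - w\<close>, and \<open>v = - Q\<inverse> x'\<close> makes \<open>x' \<bullet> Q\<inverse> x'\<close> appear with a negative sign.
  The remaining cross term with \<open>w\<close> is absorbed by \<open>\<eta> \<parallel>v\<parallel>\<^sup>2\<close>, at the price
  \<open>\<parallel>w\<parallel>\<^sup>2 / \<eta>\<close>.\<close>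

lemma closed_loop_dissipation:
  fixes A Q :: "real ^ 'n ^ 'n" and B :: "real ^ 'm ^ 'n" and S :: "real ^ 'n ^ 'p"
  assumes LMI: "pos_semidef
      (((Q - mat (\<eta> + \<beta>) ||| 0 ||| 0 ||| 0 ||| 0) ///
        (0 ||| 0 ||| 0 ||| Q ||| 0) ///
        (0 ||| 0 ||| 0 ||| Y ||| 0) ///
        (0 ||| Q ||| transpose Y ||| Q ||| transpose S) ///
        (0 ||| 0 ||| 0 ||| S ||| mat 1))
       - \<alpha> *\<^sub>R ((N ||| 0 ||| 0) /// 0 /// 0))"
    and N: "\<And>v. 0 \<le> vjoin (vjoin v (transpose A *v v)) (transpose B *v v)
              \<bullet> (N *v vjoin (vjoin v (transpose A *v v)) (transpose B *v v))"
    and Q: "pos_def Q" and "\<alpha> \<ge> 0" "\<beta> \<ge> 0" and \<eta>: "\<eta> > 0"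
    and next_x: "x' = A *v x + B *v ((Y ** matrix_inv Q) *v x) + w"
  shows "x' \<bullet> (matrix_inv Q *v x') \<le> x \<bullet> (matrix_inv Q *v x) + (norm w)\<^sup>2 / \<eta>"
proof -
  define P where "P = matrix_inv Q"
  define v g where "v = - (P *v x')" and "g = P *v x"
  define c where "c = vjoin (vjoin v (transpose A *v v)) (transpose B *v v)"
  have Qv: "Q *v v = - x'" and Qg: "Q *v g = x"
    using pos_def_matrix_inv(1)[OF Q]
    by (simp_all add: v_def g_def P_def matrix_vector_mul_assoc matrix_vector_mult_minus)
  have Yg: "A *v x + B *v (Y *v g) = x' - w"
    by (simp add: next_x g_def P_def matrix_vector_mul_assoc)
  have sym: "transpose Q = Q"
    using Q by (simp add: pos_def_def)
  have AQ: "(transpose A *v v) \<bullet> (Q *v g) = v \<bullet> (A *v (Q *v g))"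
      "g \<bullet> (Q *v (transpose A *v v)) = v \<bullet> (A *v (Q *v g))"
    by (metis inner_commute inner_transpose_mult sym)+
  have BY: "(transpose B *v v) \<bullet> (Y *v g) = v \<bullet> (B *v (Y *v g))"
      "g \<bullet> (transpose Y *v (transpose B *v v)) = v \<bullet> (B *v (Y *v g))"
    by (metis inner_commute inner_transpose_mult)+
  let ?z = "vjoin (vjoin c g) (0 :: real ^ 'p)"
  have cross: "v \<bullet> (A *v (Q *v g)) + v \<bullet> (B *v (Y *v g)) = v \<bullet> (x' - w)"
    by (simp add: Qg inner_add_right flip: Yg)
  have "0 \<le> ?z \<bullet> ((((Q - mat (\<eta> + \<beta>) ||| 0 ||| 0 ||| 0 ||| 0) ///
        (0 ||| 0 ||| 0 ||| Q ||| 0) ///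
        (0 ||| 0 ||| 0 ||| Y ||| 0) ///
        (0 ||| Q ||| transpose Y ||| Q ||| transpose S) ///
        (0 ||| 0 ||| 0 ||| S ||| mat 1))
       - \<alpha> *\<^sub>R ((N ||| 0 ||| 0) /// 0 /// 0)) *v ?z)"
    using LMI unfolding pos_semidef_def by blast
  also have "\<dots> = v \<bullet> (Q *v v) - (\<eta> + \<beta>) * (norm v)\<^sup>2
      + 2 * (v \<bullet> (A *v (Q *v g)) + v \<bullet> (B *v (Y *v g))) + g \<bullet> (Q *v g) - \<alpha> * (c \<bullet> (N *v c))"
    by (simp add: c_def matrix_vector_mult_diff_rdistrib inner_add_right inner_diff_right AQ BY
          power2_norm_eq_inner del: transpose_matrix_vector flip: scaleR_matrix_vector_assoc)
  also have "\<dots> \<le> - (x' \<bullet> (P *v x')) + x \<bullet> (P *v x) + (- 2 * (v \<bullet> w) - \<eta> * (norm v)\<^sup>2)"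
  proof -
    have "0 \<le> \<alpha> * (c \<bullet> (N *v c))" "0 \<le> \<beta> * (norm v)\<^sup>2"
      using N[of v] \<open>\<alpha> \<ge> 0\<close> \<open>\<beta> \<ge> 0\<close> by (simp_all add: c_def)
    moreover have "v \<bullet> (Q *v v) = x' \<bullet> (P *v x')" "g \<bullet> (Q *v g) = x \<bullet> (P *v x)"
        "v \<bullet> (x' - w) = - (x' \<bullet> (P *v x')) - v \<bullet> w"
      unfolding Qv Qg by (simp_all add: v_def g_def inner_commute inner_diff_right)
    ultimately show ?thesis
      unfolding cross by (simp add: algebra_simps)
  qed
  also have "- 2 * (v \<bullet> w) - \<eta> * (norm v)\<^sup>2 \<le> (norm w)\<^sup>2 / \<eta>"
  proof -
    have "0 \<le> (norm (w + \<eta> *\<^sub>R v))\<^sup>2 / \<eta>"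
      using \<eta> by simp
    also have "\<dots> = (norm w)\<^sup>2 / \<eta> + 2 * (v \<bullet> w) + \<eta> * (norm v)\<^sup>2"
      using \<eta> by (simp add: power2_norm_eq_inner inner_simps inner_commute[of w v] field_simps)
    finally show ?thesis
      by simp
  qed
  finally show ?thesis
    by (simp add: P_def)
qed

section \<open>Recursive feasibility\<close>

text \<open>The step from \<open>\<Delta>\<^sub>t\<close> to \<open>\<Delta>\<^sub>t\<^sub>+\<^sub>1\<close> subtracts the growth of \<open>x\<^sub>t \<bullet> P x\<^sub>t\<close> when
  \<open>P\<close> is updated at time \<open>t\<close>, which the comparison constraint at that time bounds by \<open>\<Delta>\<^sub>t\<close>; for \<open>t = 0\<close> there is no such constraint, and
  \<open>\<Delta>\<^sub>1 = 0\<close>.\<close>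

lemma slack_Suc_nonneg:
  assumes "\<And>s. t = Suc s \<Longrightarrow> x t \<bullet> (P t *v x t) \<le> x t \<bullet> (P s *v x t) + slack P x t"
  shows "0 \<le> slack P x (Suc t)"
  using assms by (cases t) auto

theorem lemma4:
  fixes A :: "real ^ 'n ^ 'n" and B :: "real ^ 'm ^ 'n"
    and C1 :: "real ^ 'n ^ 'p1" and D1 :: "real ^ 'm ^ 'p1"
    and C2 :: "real ^ 'n ^ 'p2" and D2 :: "real ^ 'm ^ 'p2"
    and y2max :: "'p2 \<Rightarrow> real"
    and xdp xd wd :: "'j::finite \<Rightarrow> real ^ 'n" and ud :: "'j \<Rightarrow> real ^ 'm"
    and \<Phi>11 :: "real ^ 'n ^ 'n" and \<Phi>12 :: "real ^ 'j ^ 'n" and \<Phi>22 :: "real ^ 'j ^ 'j"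
    and N :: "real ^ (('n + 'n) + 'm) ^ (('n + 'n) + 'm)"
    and x w :: "nat \<Rightarrow> real ^ 'n" and u :: "nat \<Rightarrow> real ^ 'm"
    and y1 :: "nat \<Rightarrow> real ^ 'p1" and y2 :: "nat \<Rightarrow> real ^ 'p2"
    and \<sigma> r \<eta> \<alpha> \<beta> :: "nat \<Rightarrow> real"
    and Q P :: "nat \<Rightarrow> real ^ 'n ^ 'n" and Y K :: "nat \<Rightarrow> real ^ 'n ^ 'm"
    and t :: nat
  assumes stabilizable: "stabilizable A B"
    and detectable: "detectable C1 A"
    and y2max: "\<And>v. y2max v \<ge> 0"
    and data: "\<And>j. xdp j = A *v xd j + B *v ud j + wd j"
    and \<Phi>11: "transpose \<Phi>11 = \<Phi>11"
    and \<Phi>22: "transpose \<Phi>22 = \<Phi>22" "pos_def (- \<Phi>22)"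
    and noise: "noise_bound \<Phi>11 \<Phi>12 \<Phi>22 (of_cols wd)"
    and N: "N = data_matrix \<Phi>11 \<Phi>12 \<Phi>22 (of_cols xdp) (of_cols xd) (of_cols ud)"
    and state: "\<And>s. x (Suc s) = A *v x s + B *v u s + w s"
    and output1: "\<And>s. y1 s = C1 *v x s + D1 *v u s"
    and output2: "\<And>s. y2 s = C2 *v x s + D2 *v u s"
    and r_pos: "\<And>s. r s > 0"
    and \<sigma>_pos: "\<And>s. \<sigma> s > 0"
    and energy: "\<And>s. summable (\<lambda>i. (norm (w (s + i)))\<^sup>2)"
                "\<And>s. (\<Sum>i. (norm (w (s + i)))\<^sup>2) \<le> \<sigma> s"
    and solution: "\<And>s. s \<le> t \<Longrightarrow>
          mpc_solution N C1 D1 C2 D2 y2max \<sigma> r P x s (\<eta> s) (Q s) (Y s) (\<alpha> s) (\<beta> s)"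
    and P: "\<And>s. s \<le> t \<Longrightarrow> P s = matrix_inv (Q s)"
    and K: "\<And>s. s \<le> t \<Longrightarrow> K s = Y s ** matrix_inv (Q s)"
    and control: "\<And>s. s \<le> t \<Longrightarrow> u s = K s *v x s"
    and \<sigma>_next: "\<sigma> (Suc t) \<le> \<sigma> t - (norm (w t))\<^sup>2"
    and r_next: "r (Suc t) = r t"
  shows "mpc_feasible N C1 D1 C2 D2 y2max \<sigma> r P x (Suc t) \<and>
         mpc_solution N C1 D1 C2 D2 y2max \<sigma> r P x (Suc t) (\<eta> t) (Q t) (Y t) (\<alpha> t) (\<beta> t)"
proof -
  note sol = solution[OF order.refl, unfolded mpc_solution_def]
  have pos: "\<eta> t > 0" "\<alpha> t \<ge> 0" "\<beta> t > 0"
    using sol by auto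
  have Q: "pos_def (Q t)"
    by (rule pos_def_upper_left) (use sol in auto)
  have energy_t: "x t \<bullet> (P t *v x t) + \<sigma> t / \<eta> t \<le> r t"
    using sol pos_semidef_doubly_bordered_iff[OF Q, of "inverse (\<sigma> t) * \<eta> t" "r t" "x t"]
      pos(1) \<sigma>_pos[of t] by (simp add: P field_simps)
  have decrease: "x (Suc t) \<bullet> (P t *v x (Suc t)) \<le> x t \<bullet> (P t *v x t) + (norm (w t))\<^sup>2 / \<eta> t"
    unfolding P[OF order.refl]
  proof (rule closed_loop_dissipation[where S = "C1 ** Q t + D1 ** Y t" and \<alpha> = "\<alpha> t" and \<beta> = "\<beta> t" and N = N])
    show "x (Suc t) = A *v x t + B *v ((Y t ** matrix_inv (Q t)) *v x t) + w t"
      by (simp add: state control K)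
    show "0 \<le> vjoin (vjoin v (transpose A *v v)) (transpose B *v v)
        \<bullet> (N *v vjoin (vjoin v (transpose A *v v)) (transpose B *v v))" for v
      unfolding N by (rule data_matrix_consistent_nonneg[OF data \<Phi>22(1) noise])
  qed (use sol pos Q in \<open>auto intro: less_imp_le\<close>)
  have "\<sigma> (Suc t) / \<eta> t \<le> \<sigma> t / \<eta> t - (norm (w t))\<^sup>2 / \<eta> t"
    using divide_right_mono[OF \<sigma>_next, of "\<eta> t"] pos(1) by (simp add: diff_divide_distrib)
  then have "x (Suc t) \<bullet> (P t *v x (Suc t)) + \<sigma> (Suc t) / \<eta> t \<le> r (Suc t)"
    using energy_t decrease r_next by linarith
  then have energy_Suc: "pos_semidef
      (((mat (r (Suc t)) :: real ^ 1 ^ 1) ||| rowvector (x (Suc t)) ||| (mat 1 :: real ^ 1 ^ 1)) ///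
       (columnvector (x (Suc t)) ||| Q t ||| 0) ///
       (mat 1 ||| 0 ||| mat (inverse (\<sigma> (Suc t)) * \<eta> t)))"
    using pos_semidef_doubly_bordered_iff[OF Q, of "inverse (\<sigma> (Suc t)) * \<eta> t"]
      pos(1) \<sigma>_pos[of "Suc t"] by (simp add: P field_simps)
  have "0 \<le> slack P x (Suc t)"
  proof (rule slack_Suc_nonneg)
    fix s assume "t = Suc s"
    then show "x t \<bullet> (P t *v x t) \<le> x t \<bullet> (P s *v x t) + slack P x t"
      using sol pos_semidef_bordered_iff[OF Q, of _ "x t"] by (simp add: P)
  qed
  \<comment> \<open>The old \<open>P\<close> is the inverse of \<open>Q t\<close>, so the energy terms on both sides of the
    Schur complement cancel.\<close>
  then have "pos_semidef
      (((mat (x (Suc t) \<bullet> (P (Suc t - 1) *v x (Suc t)) + slack P x (Suc t)) :: real ^ 1 ^ 1)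
          ||| rowvector (x (Suc t))) ///
       (columnvector (x (Suc t)) ||| Q t))"
    by (simp add: pos_semidef_bordered_iff[OF Q] P)
  then have "mpc_solution N C1 D1 C2 D2 y2max \<sigma> r P x (Suc t) (\<eta> t) (Q t) (Y t) (\<alpha> t) (\<beta> t)"
    using sol energy_Suc unfolding mpc_solution_def r_next by blast
  then show ?thesis
    unfolding mpc_feasible_def by blast
qed

end
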